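(* Let $X$ and $Y$ be compact metric spaces, $G$ a closed relation on $X$ and $H$ a closed relation on $Y$. If $G$ and $H$ are topological conjugates, then the following statements are equivalent. 1. No periodic point is generated by $G$. 2. No periodic point is generated by $H$.
   Context: A closed relation on a compact metric space $X$ is a closed subset $G\subseteq X\times X$. Closed relations $G$ on $X$ and $H$ on $Y$ are topological conjugates if there is a homeomorphism $\varphi:X\to Y$ such that for each $(x,y)\in X\times X$: $(x,y)\in G\iff(\varphi(x),\varphi(y))\in H$. The infinite Mahavier product is $\star_{n=1}^{\infty}G^{-1}=\{(x_1,x_2,\dots)\in\prod_{i=1}^\infty X : (x_{i+1},x_i)\in G\text{ for all }i\ge1\}$. The shift map $\sigma$ on it is $\sigma(x_1,x_2,x_3,\dots)=(x_2,x_3,\dots)$. A periodic point generated by $G$ is a point $\mathbf x\in\star_{n=1}^{\infty}G^{-1}$ with $\sigma^n(\mathbf x)=\mathbf x$ for some positive integer $n$; no periodic point is generated by $G$ if there is no such $\mathbf x$. *)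

theory Defs
  imports "HOL-Analysis.Analysis"
begin

definition closed_relation :: "'a::metric_space set \<Rightarrow> ('a \<times> 'a) set \<Rightarrow> bool" where
  "closed_relation X G \<longleftrightarrow> closedin (top_of_set (X \<times> X)) G"

definition topological_conjugates ::
  "'a::metric_space set \<Rightarrow> ('a \<times> 'a) set \<Rightarrow> 'b::metric_space set \<Rightarrow> ('b \<times> 'b) set \<Rightarrow> bool" where
  "topological_conjugates X G Y H \<longleftrightarrow>
    (\<exists>\<phi> \<psi>. homeomorphism X Y \<phi> \<psi> \<and>
      (\<forall>(x, y) \<in> X \<times> X. (x, y) \<in> G \<longleftrightarrow> (\<phi> x, \<phi> y) \<in> H))"

text \<open>The infinite Mahavier product of the inverse relation of G. Sequences are indexed
  from 0, so the coordinate written x with index i in the literature is x (i - 1) here.\<close>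

definition mahavier_product_inverse :: "'a set \<Rightarrow> ('a \<times> 'a) set \<Rightarrow> (nat \<Rightarrow> 'a) set" where
  "mahavier_product_inverse X G = {x \<in> UNIV \<rightarrow> X. \<forall>i. (x (Suc i), x i) \<in> G}"

definition shift_map :: "(nat \<Rightarrow> 'a) \<Rightarrow> (nat \<Rightarrow> 'a)" where
  "shift_map x = (\<lambda>i. x (Suc i))"

definition periodic_point :: "'a set \<Rightarrow> ('a \<times> 'a) set \<Rightarrow> (nat \<Rightarrow> 'a) \<Rightarrow> bool" where
  "periodic_point X G x \<longleftrightarrow>
    x \<in> mahavier_product_inverse X G \<and> (\<exists>n::nat. n > 0 \<and> (shift_map ^^ n) x = x)"

definition no_periodic_point :: "'a set \<Rightarrow> ('a \<times> 'a) set \<Rightarrow> bool" where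
  "no_periodic_point X G \<longleftrightarrow> \<not> (\<exists>x. periodic_point X G x)"

end

theory Submission
  imports Defs
begin

text \<open>A conjugacy \<open>\<phi>\<close> acts on sequences coordinate by coordinate. This action sends the Mahavier
  product of the inverse of \<open>G\<close> into that of the inverse of \<open>H\<close>, because membership there is a
  condition on pairs of neighbouring coordinates and \<open>\<phi>\<close> preserves the relation. It also commutes
  with the shift, because the shift only renames indices. So a periodic point generated by \<open>G\<close> is
  sent to one generated by \<open>H\<close> with the same period. Conjugacy is symmetric, since the inverse
  homeomorphism is again a conjugacy, and the other direction of the equivalence follows.\<close>

lemma funpow_shift_map_comp: "(shift_map ^^ n) (f \<circ> x) = f \<circ> (shift_map ^^ n) x"
  by (induction n) (auto simp: shift_map_def)

lemma periodic_point_comp: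
  assumes "f ` X \<subseteq> Y"
    and "\<And>a b. a \<in> X \<Longrightarrow> b \<in> X \<Longrightarrow> (a, b) \<in> G \<Longrightarrow> (f a, f b) \<in> H"
    and "periodic_point X G x"
  shows "periodic_point Y H (f \<circ> x)"
proof -
  have x: "x \<in> mahavier_product_inverse X G"
    using assms(3) by (simp add: periodic_point_def)
  obtain n where n: "n > 0" "(shift_map ^^ n) x = x"
    using assms(3) by (auto simp: periodic_point_def)
  have "f \<circ> x \<in> mahavier_product_inverse Y H"
    using x assms(1,2) by (auto simp: mahavier_product_inverse_def Pi_iff)
  moreover have "(shift_map ^^ n) (f \<circ> x) = f \<circ> x"
    by (simp only: funpow_shift_map_comp n(2))
  ultimately show ?thesis
    using n(1) by (auto simp: periodic_point_def)
qed

lemma topological_conjugates_sym: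
  assumes "topological_conjugates X G Y H"
  shows "topological_conjugates Y H X G"
proof -
  obtain \<phi> \<psi> where hom: "homeomorphism X Y \<phi> \<psi>"
    and iff: "\<And>a b. a \<in> X \<Longrightarrow> b \<in> X \<Longrightarrow> (a, b) \<in> G \<longleftrightarrow> (\<phi> a, \<phi> b) \<in> H"
    using assms by (auto simp: topological_conjugates_def)
  have "(c, d) \<in> H \<longleftrightarrow> (\<psi> c, \<psi> d) \<in> G" if "c \<in> Y" "d \<in> Y" for c d
  proof -
    have "\<psi> c \<in> X" "\<psi> d \<in> X" "\<phi> (\<psi> c) = c" "\<phi> (\<psi> d) = d"
      using hom that by (auto simp: homeomorphism_def)
    then show ?thesis
      using iff[of "\<psi> c" "\<psi> d"] by simp
  qed
  moreover have "homeomorphism Y X \<psi> \<phi>"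
    using hom by (rule homeomorphism_symD)
  ultimately show ?thesis
    unfolding topological_conjugates_def by (intro exI[of _ \<psi>] exI[of _ \<phi>]) simp
qed

lemma topological_conjugates_no_periodic_point:
  assumes "topological_conjugates X G Y H" and "no_periodic_point Y H"
  shows "no_periodic_point X G"
proof -
  obtain \<phi> \<psi> where hom: "homeomorphism X Y \<phi> \<psi>"
    and rel: "\<And>a b. a \<in> X \<Longrightarrow> b \<in> X \<Longrightarrow> (a, b) \<in> G \<Longrightarrow> (\<phi> a, \<phi> b) \<in> H"
    using assms(1) by (auto simp: topological_conjugates_def)
  have "\<phi> ` X \<subseteq> Y"
    using hom by (simp add: homeomorphism_def)
  then have "periodic_point Y H (\<phi> \<circ> x)" if "periodic_point X G x" for x
    using rel that by (rule periodic_point_comp)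
  then show ?thesis
    using assms(2) by (auto simp: no_periodic_point_def)
qed

theorem theorem5p8:
  fixes X :: "'a::metric_space set" and Y :: "'b::metric_space set"
    and G :: "('a \<times> 'a) set" and H :: "('b \<times> 'b) set"
  assumes "compact X" and "compact Y"
    and "closed_relation X G" and "closed_relation Y H"
    and "topological_conjugates X G Y H"
  shows "no_periodic_point X G \<longleftrightarrow> no_periodic_point Y H"
proof
  show "no_periodic_point Y H" if "no_periodic_point X G"
    using topological_conjugates_sym[OF assms(5)] that
    by (rule topological_conjugates_no_periodic_point)
  show "no_periodic_point X G" if "no_periodic_point Y H"
    using assms(5) that by (rule topological_conjugates_no_periodic_point)
qed

end
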